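(* Let $0<q<p$. For $\alpha>-1$ and $s>0$, $$L_{p,q}\{t^\alpha\}(s)=\frac{\Gamma_{p,q}(\alpha+1)}{p^{\frac{\alpha(\alpha+1)}{2}}\,s^{\alpha+1}}.$$
   Context: Let $0<q<p$ be real numbers. For an integer $n\ge 0$, $[n]_{p,q}=\frac{p^n-q^n}{p-q}$, $[n]_{p,q}!=\prod_{k=1}^n[k]_{p,q}$ for $n\ge1$, $[0]_{p,q}!=1$. The big $(p,q)$-exponential is $E_{p,q}(z)=\sum_{n=0}^\infty\frac{q^{\binom n2}}{[n]_{p,q}!}z^n$. The improper $(p,q)$-integral of $f$ on $[0,\infty)$ is $\int_0^\infty f(x)\,d_{p,q}x=(p-q)\sum_{j=-\infty}^{\infty}\frac{q^j}{p^{j+1}}f\!\left(\frac{q^j}{p^{j+1}}\right)$. The $(p,q)$-Laplace transform of the first kind of a function $f(t)$ is $L_{p,q}\{f(t)\}(s)=\int_0^\infty f(t)E_{p,q}(-qts)\,d_{p,q}t$, $s>0$. The $(p,q)$-Gamma function is here defined by $\Gamma_{p,q}(z)=p^{\frac{z(z-1)}{2}}\int_0^\infty t^{z-1}E_{p,q}(-qt)\,d_{p,q}t$.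
   Formalization: The formula is proved assuming that the two (p,q)-integrals defining L{t^α}(s) and Γ(α+1) both converge; for general p, q, s they diverge (e.g. p=3, q=1, s=3/2: Γ diverges), so the formula is then undefined. *)

theory Defs
  imports Complex_Main
begin

definition pq_num :: "real \<Rightarrow> real \<Rightarrow> nat \<Rightarrow> real" where
  "pq_num p q n = (p ^ n - q ^ n) / (p - q)"

definition pq_fact :: "real \<Rightarrow> real \<Rightarrow> nat \<Rightarrow> real" where
  "pq_fact p q n = (\<Prod>k=1..n. pq_num p q k)"

definition pq_Exp :: "real \<Rightarrow> real \<Rightarrow> real \<Rightarrow> real" where
  "pq_Exp p q z = (\<Sum>n. q ^ (n choose 2) / pq_fact p q n * z ^ n)"

definition pq_node :: "real \<Rightarrow> real \<Rightarrow> int \<Rightarrow> real" where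
  "pq_node p q j = q powi j / p powi (j + 1)"

definition pq_term :: "real \<Rightarrow> real \<Rightarrow> (real \<Rightarrow> real) \<Rightarrow> int \<Rightarrow> real" where
  "pq_term p q f j = pq_node p q j * f (pq_node p q j)"

text \<open>
  A bilateral series over the integers converges if its two halves (indices \<open>j \<ge> 0\<close> and
  \<open>j < 0\<close>) converge separately; its value is then the sum of the values of the halves.
  Absolute convergence is not required.  The value \<open>pq_integral p q f\<close> is meaningful only
  if \<open>pq_integrable p q f\<close> holds.
\<close>

definition pq_integrable :: "real \<Rightarrow> real \<Rightarrow> (real \<Rightarrow> real) \<Rightarrow> bool" where
  "pq_integrable p q f \<longleftrightarrow>
     summable (\<lambda>n. pq_term p q f (int n)) \<and> summable (\<lambda>n. pq_term p q f (- int (Suc n)))"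

definition pq_integral :: "real \<Rightarrow> real \<Rightarrow> (real \<Rightarrow> real) \<Rightarrow> real" where
  "pq_integral p q f =
     (p - q) * ((\<Sum>n. pq_term p q f (int n)) + (\<Sum>n. pq_term p q f (- int (Suc n))))"

definition pq_laplace :: "real \<Rightarrow> real \<Rightarrow> (real \<Rightarrow> real) \<Rightarrow> real \<Rightarrow> real" where
  "pq_laplace p q f s = pq_integral p q (\<lambda>t. f t * pq_Exp p q (- q * t * s))"

definition pq_Gamma :: "real \<Rightarrow> real \<Rightarrow> real \<Rightarrow> real" where
  "pq_Gamma p q z =
     p powr (z * (z - 1) / 2) * pq_integral p q (\<lambda>t. t powr (z - 1) * pq_Exp p q (- q * t))"

end

theory Submission
  imports Defs
begin

text \<open>
  Put \<open>Q = q / p\<close>.  The functional equation \<open>E(z) = (1 + (1 - Q) z) E(Q z)\<close> shows that the zeros of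
  \<open>E\<close> are the points \<open>z\<close> with \<open>(1 - Q) Q\<^sup>k z = -1\<close>, and that along the nodes \<open>Q\<^sup>j / p\<close> with \<open>j \<rightarrow> -\<infinity>\<close>
  the integrand grows without bound unless it hits such a zero.  Hence integrability at a
  parameter \<open>s\<close> forces \<open>(1 - Q) s\<close> to be an integer power of \<open>Q\<close>.  Having this at \<open>s\<close> and at \<open>1\<close> makes
  \<open>s\<close> itself an integer power of \<open>Q\<close>, so that the substitution \<open>t \<mapsto> t / s\<close> is a mere shift of the
  bilateral series.
\<close>

section \<open>The power series of \<open>pq_Exp\<close>: convergence, functional equation,
  zeros\<close>

lemma pq_coeff_rec:
  assumes "0 < q" "q < p"
  shows "q ^ (Suc n choose 2) / pq_fact p q (Suc n) * (1 - (q/p) ^ Suc n) =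
    (1 - q/p) * (q/p) ^ n * (q ^ (n choose 2) / pq_fact p q n)"
proof -
  have lt: "q ^ Suc n < p ^ Suc n"
    using assms by (intro power_strict_mono) auto
  have "pq_fact p q (Suc n) = pq_fact p q n * pq_num p q (Suc n)"
    by (simp add: pq_fact_def)
  moreover have "q ^ (Suc n choose 2) = q ^ (n choose 2) * q ^ n"
    by (simp add: numeral_2_eq_2 power_add)
  moreover have step: "q ^ n / pq_num p q (Suc n) * (1 - (q/p) ^ Suc n) = (1 - q/p) * (q/p) ^ n"
    using assms lt by (simp add: pq_num_def power_divide field_simps)
  ultimately have "q ^ (Suc n choose 2) / pq_fact p q (Suc n) * (1 - (q/p) ^ Suc n) =
      q ^ (n choose 2) / pq_fact p q n * (q ^ n / pq_num p q (Suc n) * (1 - (q/p) ^ Suc n))"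
    by (metis mult.assoc times_divide_times_eq)
  then show ?thesis
    unfolding step by (simp only: mult.commute)
qed

text \<open>Since \<open>1 - Q \<le> 1 - Q ^ Suc n\<close>, the coefficient recurrence bounds the
  ratio of consecutive terms by \<open>Q ^ n * \<bar>z\<bar>\<close>, which tends to 0 for every
  \<open>z\<close>.\<close>

lemma pq_Exp_summable:
  assumes "0 < q" "q < p"
  shows "summable (\<lambda>n. q ^ (n choose 2) / pq_fact p q n * z ^ n)"
proof -
  define Q where "Q = q / p"
  define c where "c n = q ^ (n choose 2) / pq_fact p q n" for n
  have Q: "0 < Q" "Q < 1"
    using assms by (auto simp: Q_def)
  have "(\<lambda>n. Q ^ n * \<bar>z\<bar>) \<longlonglongrightarrow> 0 * \<bar>z\<bar>"
    using Q by (intro tendsto_intros LIMSEQ_realpow_zero) auto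
  then have "eventually (\<lambda>n. Q ^ n * \<bar>z\<bar> < 1/2) sequentially"
    by (intro order_tendstoD) auto
  then obtain N where N: "\<And>n. n \<ge> N \<Longrightarrow> Q ^ n * \<bar>z\<bar> < 1/2"
    by (auto simp: eventually_sequentially)
  have "summable (\<lambda>n. c n * z ^ n)"
  proof (rule summable_ratio_test[of "1/2" N])
    fix n assume n: "N \<le> n"
    have rec: "c (Suc n) * (1 - Q ^ Suc n) = (1 - Q) * Q ^ n * c n"
      using pq_coeff_rec[OF assms] by (simp add: c_def Q_def)
    have le: "1 - Q \<le> 1 - Q ^ Suc n"
      using Q power_decreasing[of 1 "Suc n" Q] by simp
    have "\<bar>c (Suc n)\<bar> * (1 - Q) \<le> \<bar>c (Suc n)\<bar> * (1 - Q ^ Suc n)"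
      using le by (intro mult_left_mono) auto
    also have "\<dots> = \<bar>c (Suc n) * (1 - Q ^ Suc n)\<bar>"
      using le Q by (simp only: abs_mult)
    also have "\<dots> = (Q ^ n * \<bar>c n\<bar>) * (1 - Q)"
      unfolding rec using Q by (simp add: abs_mult)
    finally have "\<bar>c (Suc n)\<bar> \<le> Q ^ n * \<bar>c n\<bar>"
      using Q by simp
    then have "\<bar>c (Suc n)\<bar> * \<bar>z\<bar> ^ Suc n \<le> Q ^ n * \<bar>c n\<bar> * \<bar>z\<bar> ^ Suc n"
      by (intro mult_right_mono) auto
    also have "\<dots> = (Q ^ n * \<bar>z\<bar>) * (\<bar>c n\<bar> * \<bar>z\<bar> ^ n)"
      by simp
    also have "\<dots> \<le> 1/2 * (\<bar>c n\<bar> * \<bar>z\<bar> ^ n)"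
      using N[OF n] by (intro mult_right_mono) auto
    finally show "norm (c (Suc n) * z ^ Suc n) \<le> 1/2 * norm (c n * z ^ n)"
      by (simp add: abs_mult power_abs)
  qed auto
  then show ?thesis
    by (simp add: c_def)
qed

text \<open>Both sides have the same coefficients: this is the coefficient recurrence with the
  \<open>Q ^ Suc n\<close> part moved to the other side.\<close>

lemma pq_Exp_functional_equation:
  assumes "0 < q" "q < p"
  shows "pq_Exp p q z = (1 + (1 - q/p) * z) * pq_Exp p q (q/p * z)"
proof -
  define Q where "Q = q / p"
  define c where "c n = q ^ (n choose 2) / pq_fact p q n" for n
  have sm: "summable (\<lambda>n. c n * z ^ n)" for z
    using pq_Exp_summable[OF assms] by (simp add: c_def)
  have E: "pq_Exp p q z = (\<Sum>n. c n * z ^ n)" for z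
    by (simp add: pq_Exp_def c_def)
  have rec: "c (Suc n) = (1 - Q) * Q ^ n * c n + c (Suc n) * Q ^ Suc n" for n
  proof -
    have "c (Suc n) * (1 - Q ^ Suc n) = (1 - Q) * Q ^ n * c n"
      using pq_coeff_rec[OF assms] by (simp add: c_def Q_def)
    then show ?thesis
      by (simp only: right_diff_distrib mult_1_right)
  qed
  have sums: "(\<lambda>n. (1 - Q) * z * (c n * (Q*z) ^ n) + c (Suc n) * (Q*z) ^ Suc n) sums
      ((1 - Q) * z * pq_Exp p q (Q*z) + (pq_Exp p q (Q*z) - c 0))"
    unfolding E using summable_sums[OF sm[of "Q*z"]]
    by (intro sums_add sums_mult) (simp_all only: sums_Suc_iff[of "\<lambda>n. c n * (Q*z) ^ n"], simp_all)
  have "(1 - Q) * z * (c n * (Q*z) ^ n) + c (Suc n) * (Q*z) ^ Suc n = c (Suc n) * z ^ Suc n" for n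
    \<comment> \<open>Only the coefficient on the right is expanded; the one on the left
      stays.\<close>
    by (subst (2) rec) (simp add: power_mult_distrib algebra_simps)
  with sums have "(\<lambda>n. c (Suc n) * z ^ Suc n) sums
      ((1 - Q) * z * pq_Exp p q (Q*z) + (pq_Exp p q (Q*z) - c 0))"
    by simp
  then have "(\<lambda>n. c n * z ^ n) sums ((1 - Q) * z * pq_Exp p q (Q*z) + pq_Exp p q (Q*z))"
    by (subst (asm) sums_Suc_iff) simp
  then show ?thesis
    unfolding E[of z] Q_def by (simp add: sums_iff algebra_simps)
qed

lemma pq_Exp_tendsto:
  assumes "0 < q" "q < p"
  shows "(\<lambda>n. pq_Exp p q ((q/p) ^ n * z)) \<longlonglongrightarrow> 1"
proof -
  have "isCont (\<lambda>x. \<Sum>n. q ^ (n choose 2) / pq_fact p q n * x ^ n) 0"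
    by (rule isCont_powser[of _ 1]) (use pq_Exp_summable[OF assms, of 1] in simp_all)
  then have "isCont (pq_Exp p q) 0"
    by (simp add: pq_Exp_def[abs_def])
  moreover have "(\<lambda>n. (q/p) ^ n * z) \<longlonglongrightarrow> 0 * z"
    using assms by (intro tendsto_intros LIMSEQ_realpow_zero) auto
  ultimately have "(\<lambda>n. pq_Exp p q ((q/p) ^ n * z)) \<longlonglongrightarrow> pq_Exp p q 0"
    by (intro isCont_tendsto_compose[of 0 "pq_Exp p q"]) auto
  moreover have "pq_Exp p q 0 = 1"
    using powser_zero[of "\<lambda>n. q ^ (n choose 2) / pq_fact p q n"]
    by (simp add: pq_Exp_def pq_fact_def numeral_2_eq_2)
  ultimately show ?thesis
    by simp
qed

text \<open>If no factor \<open>1 + (1 - Q) Q ^ k z\<close> vanishes, the functional equation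
  carries a zero at \<open>z\<close> to all points \<open>Q ^ n z\<close>, although the values there
  tend to 1.\<close>

lemma pq_Exp_zeroD:
  assumes "0 < q" "q < p" "pq_Exp p q z = 0"
  shows "\<exists>k. (1 - q/p) * ((q/p) ^ k * z) = -1"
proof (rule ccontr)
  assume "\<not> ?thesis"
  then have nz: "1 + (1 - q/p) * ((q/p) ^ k * z) \<noteq> 0" for k
    by (metis add_eq_0_iff)
  have "pq_Exp p q ((q/p) ^ n * z) = 0" for n
  proof (induction n)
    case (Suc n)
    then show ?case
      using nz[of n] pq_Exp_functional_equation[OF assms(1,2), of "(q/p) ^ n * z"]
      by (simp add: mult.assoc)
  qed (use assms in simp)
  then show False
    using pq_Exp_tendsto[OF assms(1,2), of z] LIMSEQ_unique[OF tendsto_const, of "0::real"]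
    by fastforce
qed

section \<open>Consequences of integrability for the parameter \<open>s\<close>\<close>

lemma pq_node_eq: "0 < p \<Longrightarrow> pq_node p q j = (q/p) powi j / p"
  by (simp add: pq_node_def power_int_add power_int_divide_distrib)

lemma pq_node_pos: "0 < q \<Longrightarrow> 0 < p \<Longrightarrow> pq_node p q j > 0"
  by (simp add: pq_node_def)

text \<open>Along the nodes tending to infinity, the terms \<open>u n\<close> must tend to 0. If
  \<open>(1 - Q) s\<close> were no power of \<open>Q\<close>, they would all be nonzero and
  eventually nondecreasing in absolute value.\<close>

lemma pq_integrable_imp_power:
  assumes q: "0 < q" "q < p" and "\<alpha> > -1" "s > 0"
    and int: "pq_integrable p q (\<lambda>t. t powr \<alpha> * pq_Exp p q (- q * t * s))"
  shows "\<exists>i. (1 - q/p) * s = (q/p) powi i"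
proof (rule ccontr)
  assume no: "\<not> ?thesis"
  define Q where "Q = q / p"
  have Q: "0 < Q" "Q < 1"
    using q by (auto simp: Q_def)
  define x where "x n = pq_node p q (- int (Suc n))" for n
  define u where "u n = x n powr (\<alpha> + 1) * pq_Exp p q (- q * x n * s)" for n
  have xpos: "x n > 0" for n
    using q by (simp add: x_def pq_node_pos)
  \<comment> \<open>The index \<open>- int (Suc n)\<close> starts at -1, and this offset cancels the
    factor \<open>q / p\<close>.\<close>
  have xQ: "q * x n = Q powi (- int n)" for n
  proof -
    have "q * x n = Q powi 1 * Q powi (- int (Suc n))"
      using q by (simp add: x_def pq_node_eq Q_def)
    also have "\<dots> = Q powi (1 + - int (Suc n))"
      using Q by (subst power_int_add) auto
    finally show ?thesis
      by simp
  qed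
  have xSuc: "x n = Q * x (Suc n)" for n
  proof -
    have "q * x n = Q * (q * x (Suc n))"
      unfolding xQ using Q by (simp only: power_int_minus power_int_of_nat) simp
    then show ?thesis
      using q by simp
  qed
  have "summable (\<lambda>n. pq_term p q (\<lambda>t. t powr \<alpha> * pq_Exp p q (- q * t * s)) (- int (Suc n)))"
    using int by (simp add: pq_integrable_def)
  also have "(\<lambda>n. pq_term p q (\<lambda>t. t powr \<alpha> * pq_Exp p q (- q * t * s)) (- int (Suc n))) = u"
    unfolding pq_term_def x_def[symmetric] u_def[abs_def]
    using xpos by (simp add: powr_add abs_of_pos mult_ac)
  finally have lim: "u \<longlonglongrightarrow> 0"
    by (rule summable_LIMSEQ_zero)
  have Enz: "pq_Exp p q (- q * x n * s) \<noteq> 0" for n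
  proof
    assume "pq_Exp p q (- q * x n * s) = 0"
    then obtain k where "(1 - Q) * (Q ^ k * (- q * x n * s)) = -1"
      using pq_Exp_zeroD[OF q] unfolding Q_def by blast
    then have "(1 - Q) * s * (Q ^ k * (q * x n)) = 1"
      by (simp add: algebra_simps)
    then have "(1 - Q) * s = Q powi (int n - int k)"
      unfolding xQ using Q by (simp add: power_int_diff power_int_minus field_simps)
    then show False
      using no by (auto simp: Q_def)
  qed
  have unz: "u n \<noteq> 0" for n
    using Enz xpos[of n] by (simp add: u_def)
  define c where "c = (1 - Q) * s"
  have c: "c > 0"
    using Q \<open>s > 0\<close> by (simp add: c_def)
  \<comment> \<open>Beyond \<open>N\<close> the quantity \<open>c * (q * x (Suc n))\<close> exceeds
    2, so the factor \<open>1 - c * (q * x (Suc n))\<close> from the functional equation has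
    absolute value above 1.\<close>
  obtain N where N: "2 / c < (1 / Q) ^ N"
    using real_arch_pow[of "1 / Q"] Q by auto
  have mono: "\<bar>u n\<bar> \<le> \<bar>u (Suc n)\<bar>" if "n \<ge> N" for n
  proof -
    have "2 / c < (1 / Q) ^ Suc n"
      using N that Q by (intro less_le_trans[OF N] power_increasing) auto
    also have "\<dots> = q * x (Suc n)"
      unfolding xQ using Q by (simp only: power_int_minus power_int_of_nat power_one_over inverse_eq_divide)
    finally have big: "2 < c * (q * x (Suc n))"
      using c by (simp add: field_simps)
    have E: "pq_Exp p q (- q * x (Suc n) * s) =
        (1 - c * (q * x (Suc n))) * pq_Exp p q (- q * x n * s)"
      using pq_Exp_functional_equation[OF q, of "- q * x (Suc n) * s"] xSuc[of n]
      by (simp add: c_def Q_def algebra_simps)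
    have "\<bar>pq_Exp p q (- q * x n * s)\<bar> \<le> \<bar>pq_Exp p q (- q * x (Suc n) * s)\<bar>"
      unfolding E abs_mult using big by (simp add: mult_le_cancel_right1)
    moreover have "x n powr (\<alpha> + 1) \<le> x (Suc n) powr (\<alpha> + 1)"
      using xSuc[of n] xpos[of n] xpos[of "Suc n"] Q \<open>\<alpha> > -1\<close>
      by (intro powr_mono2) auto
    ultimately show ?thesis
      unfolding u_def abs_mult by (intro mult_mono) auto
  qed
  have "\<bar>u N\<bar> \<le> \<bar>u n\<bar>" if "n \<ge> N" for n
    using that by (induction n rule: dec_induct) (auto intro: order_trans mono)
  moreover have "(\<lambda>n. \<bar>u n\<bar>) \<longlonglongrightarrow> 0"
    using tendsto_rabs_zero[OF lim] .
  ultimately have "\<bar>u N\<bar> \<le> 0"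
    by (intro LIMSEQ_le_const) auto
  then show False
    using unz by simp
qed

section \<open>Bilateral series and their invariance under index shifts\<close>

definition bilateral_sums :: "(int \<Rightarrow> real) \<Rightarrow> real \<Rightarrow> bool" where
  "bilateral_sums g S \<longleftrightarrow>
     (\<exists>a b. (\<lambda>n. g (int n)) sums a \<and> (\<lambda>n. g (- int (Suc n))) sums b \<and> S = a + b)"

text \<open>The shift moves the single term \<open>g 0\<close> from the nonnegative half to the
  negative half, so convergence and the total are unchanged.\<close>

lemma bilateral_sums_shift1: "bilateral_sums (\<lambda>j. g (j + 1)) S \<longleftrightarrow> bilateral_sums g S"
proof -
  have a: "(\<lambda>n. g (int n + 1)) sums a \<longleftrightarrow> (\<lambda>n. g (int n)) sums (a + g 0)" for a
    using sums_Suc_iff[of "\<lambda>n. g (int n)" a] by (simp add: add.commute)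
  have b: "(\<lambda>n. g (- int (Suc n) + 1)) sums b \<longleftrightarrow> (\<lambda>n. g (- int (Suc n))) sums (b - g 0)" for b
    using sums_Suc_iff[of "\<lambda>n. g (- int n)" "b - g 0"] by simp
  show ?thesis
    unfolding bilateral_sums_def a b
  proof (intro iffI; elim exE conjE)
    fix a b
    assume "(\<lambda>n. g (int n)) sums (a + g 0)" "(\<lambda>n. g (- int (Suc n))) sums (b - g 0)" "S = a + b"
    then show "\<exists>a b. (\<lambda>n. g (int n)) sums a \<and> (\<lambda>n. g (- int (Suc n))) sums b \<and> S = a + b"
      by (intro exI[of _ "a + g 0"] exI[of _ "b - g 0"]) auto
  next
    fix a b
    assume "(\<lambda>n. g (int n)) sums a" "(\<lambda>n. g (- int (Suc n))) sums b" "S = a + b"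
    then show "\<exists>a b. (\<lambda>n. g (int n)) sums (a + g 0) \<and>
        (\<lambda>n. g (- int (Suc n))) sums (b - g 0) \<and> S = a + b"
      by (intro exI[of _ "a - g 0"] exI[of _ "b + g 0"]) auto
  qed
qed

lemma bilateral_sums_shift: "bilateral_sums (\<lambda>j. g (j + k)) S \<longleftrightarrow> bilateral_sums g S"
proof (induction k rule: int_induct[where k = 0])
  case (step1 k)
  then show ?case
    using bilateral_sums_shift1[of "\<lambda>j. g (j + k)" S] by (simp add: add_ac)
next
  case (step2 k)
  then show ?case
    using bilateral_sums_shift1[of "\<lambda>j. g (j + (k - 1))" S] by (simp add: algebra_simps)
qed simp

lemma bilateral_sums_mult:
  "bilateral_sums g S \<Longrightarrow> bilateral_sums (\<lambda>j. c * g j) (c * S)"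
  unfolding bilateral_sums_def by (metis sums_mult distrib_left)

lemma pq_integral_eq:
  "bilateral_sums (pq_term p q f) S \<Longrightarrow> pq_integral p q f = (p - q) * S"
  by (auto simp: bilateral_sums_def pq_integral_def sums_iff)

lemma pq_integrable_bilateral_sums:
  "pq_integrable p q f \<Longrightarrow> \<exists>S. bilateral_sums (pq_term p q f) S"
  unfolding pq_integrable_def bilateral_sums_def by (metis summable_sums)

theorem theorem3p3:
  fixes p q \<alpha> s :: real
  assumes "0 < q" and "q < p" and "\<alpha> > -1" and "s > 0"
    and "pq_integrable p q (\<lambda>t. t powr \<alpha> * pq_Exp p q (- q * t * s))"
    and "pq_integrable p q (\<lambda>t. t powr \<alpha> * pq_Exp p q (- q * t))"
  shows "pq_laplace p q (\<lambda>t. t powr \<alpha>) s =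
    pq_Gamma p q (\<alpha> + 1) / (p powr (\<alpha> * (\<alpha> + 1) / 2) * s powr (\<alpha> + 1))"
proof -
  define f where "f t = t powr \<alpha> * pq_Exp p q (- q * t)" for t
  define F where "F t = t powr \<alpha> * pq_Exp p q (- q * t * s)" for t
  have Q: "0 < q / p" "q / p < 1" and p: "0 < p"
    using assms by auto
  obtain i where i: "(1 - q/p) * s = (q/p) powi i"
    using pq_integrable_imp_power assms(1-5) by blast
  \<comment> \<open>The Gamma integral is the case of parameter 1.\<close>
  obtain l where l: "1 - q/p = (q/p) powi l"
    using pq_integrable_imp_power[of q p \<alpha> 1] assms(1-3,6) by auto
  define k where "k = i - l"
  have "s = (q/p) powi i / (1 - q/p)"
    using i Q by (simp only: nonzero_eq_divide_eq) (simp add: mult.commute)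
  also have "\<dots> = (q/p) powi k"
    unfolding l k_def using Q by (subst power_int_diff) auto
  finally have s: "s = (q/p) powi k" .
  \<comment> \<open>Scaling a node by \<open>s\<close> is a shift of its index by
    \<open>k\<close>.\<close>
  have node: "pq_node p q (j + k) = pq_node p q j * s" for j
    using p assms(1) by (simp add: pq_node_eq s power_int_add)
  \<comment> \<open>The power \<open>t powr \<alpha>\<close> contributes
    \<open>s powr - \<alpha>\<close>, and the node weight contributes one more factor
    \<open>1 / s\<close>.\<close>
  have "pq_term p q F j = s powr - (\<alpha> + 1) * pq_term p q f (j + k)" for j
  proof -
    have "pq_node p q j > 0"
      using assms p by (simp add: pq_node_pos)
    then show ?thesis
      using \<open>s > 0\<close>
      by (simp add: pq_term_def F_def f_def node powr_mult powr_add powr_diff powr_minus field_simps)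
  qed
  then have terms: "pq_term p q F = (\<lambda>j. s powr - (\<alpha> + 1) * pq_term p q f (j + k))"
    by auto
  obtain S where S: "bilateral_sums (pq_term p q f) S"
    using pq_integrable_bilateral_sums assms(6) unfolding f_def by blast
  have "bilateral_sums (pq_term p q F) (s powr - (\<alpha> + 1) * S)"
    unfolding terms using S by (intro bilateral_sums_mult) (simp add: bilateral_sums_shift)
  then have "pq_integral p q F = s powr - (\<alpha> + 1) * pq_integral p q f"
    using S by (simp add: pq_integral_eq)
  moreover have "pq_laplace p q (\<lambda>t. t powr \<alpha>) s = pq_integral p q F"
    by (simp add: pq_laplace_def F_def[abs_def])
  moreover have "pq_Gamma p q (\<alpha> + 1) = p powr (\<alpha> * (\<alpha> + 1) / 2) * pq_integral p q f"
    by (simp add: pq_Gamma_def f_def[abs_def] mult.commute)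
  ultimately show ?thesis
    \<comment> \<open>The power of \<open>p\<close> in front of the Gamma integral cancels against
      the denominator.\<close>
    using p \<open>s > 0\<close> by (simp only: powr_minus) (simp add: field_simps)
qed

end
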